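(* The generating function of the total sizes $h(s)$ of all $(s,s+1,s+2)$-core partitions is $$H(x)=\sum_{s\ge 0}h(s)x^s=\frac{x^2}{(1-2x-3x^2)^{5/2}}.$$
   Context: A partition is an $(s,s+1,s+2)$-core if no hook length of a box of its Young diagram is divisible by $s$, $s+1$ or $s+2$. $h(s)$ is the sum of the sizes of all $(s,s+1,s+2)$-core partitions (with $h(0)=h(1)=0$, the only such partition for $s\le 1$ being the empty one). *)

theory Defs
  imports Complex_Main
begin

definition is_partition :: "nat list \<Rightarrow> bool" where
  "is_partition la \<longleftrightarrow> sorted_wrt (\<lambda>a b. b \<le> a) la \<and> 0 \<notin> set la"

definition psize :: "nat list \<Rightarrow> nat" where
  "psize la = sum_list la"

text \<open>Cells of the Young diagram (English notation, 0-indexed row i, column j).\<close>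
definition cells :: "nat list \<Rightarrow> (nat \<times> nat) set" where
  "cells la = {(i, j). i < length la \<and> j < la ! i}"

definition conj_part :: "nat list \<Rightarrow> nat \<Rightarrow> nat" where
  "conj_part la j = card {i. i < length la \<and> j < la ! i}"

text \<open>Hook length of cell (i,j): arm + leg + 1.\<close>
definition hook :: "nat list \<Rightarrow> nat \<Rightarrow> nat \<Rightarrow> nat" where
  "hook la i j = (la ! i - j) + (conj_part la j - i) - 1"

definition is_core3 :: "nat \<Rightarrow> nat list \<Rightarrow> bool" where
  "is_core3 s la \<longleftrightarrow> is_partition la \<and>
     (\<forall>(i, j) \<in> cells la. \<not> s dvd hook la i j \<and> \<not> (s + 1) dvd hook la i j
                           \<and> \<not> (s + 2) dvd hook la i j)"

definition h :: "nat \<Rightarrow> nat" where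
  "h s = (\<Sum>la \<in> {la. is_core3 s la}. psize la)"

end

theory Submission
  imports Defs "HOL-Analysis.FPS_Convergence"
begin

text \<open>
  The first-column hook lengths of an \<open>(s, s+1, s+2)\<close>-core form a finite set of positive integers
  that is closed under subtracting \<open>s\<close>, \<open>s+1\<close> and \<open>s+2\<close>. Placed on an abacus with \<open>s+1\<close> runners,
  such a set is flush on every runner, and the bead counts \<open>f 0, \<dots>, f s\<close> of the runners are exactly
  the heights of a Motzkin path of length \<open>s\<close>. Reversing paths removes the part of the size that is
  antisymmetric, so that twice the total size is the sum of
  \<open>(s+1) (\<Sum>c. (f c)\<^sup>2) - (\<Sum>c. f c)\<^sup>2\<close> over all Motzkin paths \<open>f\<close>. The first-return decomposition
  turns the path statistics involved into equations for generating functions that are linear except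
  for the Motzkin series \<open>M = 1 + x M + x\<^sup>2 M\<^sup>2\<close>; all of them are rational in \<open>x\<close>, \<open>M\<close> and
  \<open>D = 1 - x - 2 x\<^sup>2 M\<close>, where \<open>D\<^sup>2 = 1 - 2 x - 3 x\<^sup>2 = (1 + x) (1 - 3 x)\<close>. Two binomial series then
  give convergence for \<open>\<bar>x\<bar> < 1/3\<close>.
\<close>

section \<open>First-column hook lengths of core partitions\<close>

lemma down_closed_eq_lessThan:
  fixes A :: "nat set"
  assumes "finite A" and down: "\<And>x y. x \<in> A \<Longrightarrow> y \<le> x \<Longrightarrow> y \<in> A"
  shows "A = {..<card A}"
proof (cases "A = {}")
  case False
  have "A = {..Max A}"
    using Max_ge[OF \<open>finite A\<close>] down[OF Max_in[OF \<open>finite A\<close> False]] by auto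
  then show ?thesis
    by (metis card_atMost lessThan_Suc_atMost)
qed simp

text \<open>For a partition this is the hook length of the cell \<open>(i, 0)\<close>: arm
  \<open>la ! i - 1\<close>, leg \<open>length la - 1 - i\<close>, and one for the cell
  itself.\<close>

definition beta :: "nat list \<Rightarrow> nat \<Rightarrow> nat" where
  "beta la i = la ! i + (length la - 1 - i)"

definition beta_set :: "nat list \<Rightarrow> nat set" where
  "beta_set la = beta la ` {..<length la}"

lemma is_partition_nth_mono:
  assumes "is_partition la" "i \<le> j" "j < length la"
  shows "la ! j \<le> la ! i"
  using assms by (cases "i = j") (auto simp: is_partition_def sorted_wrt_iff_nth_less)

lemma is_partition_nth_pos:
  assumes "is_partition la" "i < length la"
  shows "0 < la ! i"
  using assms by (metis is_partition_def nth_mem gr0I)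

lemma beta_strict_antimono:
  assumes "is_partition la" "i < j" "j < length la"
  shows "beta la j < beta la i"
  using is_partition_nth_mono[OF assms(1), of i j] assms by (simp add: beta_def)

lemma inj_on_beta:
  assumes "is_partition la"
  shows "inj_on (beta la) {..<length la}"
proof (rule inj_onI)
  fix i j assume *: "i \<in> {..<length la}" "j \<in> {..<length la}" "beta la i = beta la j"
  show "i = j"
  proof (rule ccontr)
    assume "i \<noteq> j"
    then consider "i < j" | "j < i" by linarith
    then show False
      using * beta_strict_antimono[OF assms, of i j] beta_strict_antimono[OF assms, of j i]
      by cases simp_all
  qed
qed

lemma finite_beta_set [simp]: "finite (beta_set la)"
  by (simp add: beta_set_def)

lemma card_beta_set: "is_partition la \<Longrightarrow> card (beta_set la) = length la"
  by (simp add: beta_set_def card_image inj_on_beta)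

lemma beta_set_pos: "is_partition la \<Longrightarrow> 0 \<notin> beta_set la"
  using is_partition_nth_pos[of la] by (fastforce simp: beta_set_def beta_def)

text \<open>The legs run through all numbers below \<open>length la\<close>, which is the
  cardinality of the set. Hence the size can be read off from the set alone.\<close>

lemma sum_beta_set:
  assumes "is_partition la"
  shows "\<Sum>(beta_set la) = psize la + \<Sum>{..<card (beta_set la)}"
proof -
  have "\<Sum>(beta_set la) = (\<Sum>i<length la. beta la i)"
    unfolding beta_set_def by (subst sum.reindex[OF inj_on_beta[OF assms]]) simp
  also have "\<dots> = psize la + (\<Sum>i<length la. length la - Suc i)"
    by (simp add: beta_def sum.distrib psize_def sum_list_sum_nth atLeast0LessThan del: add_diff_assoc)
  also have "(\<Sum>i<length la. length la - Suc i) = \<Sum>{..<length la}"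
    by (rule sum.nat_diff_reindex)
  finally show ?thesis
    by (simp add: card_beta_set[OF assms])
qed

lemma beta_set_inject:
  assumes la: "is_partition la" and mu: "is_partition mu" and eq: "beta_set la = beta_set mu"
  shows "la = mu"
proof -
  let ?b = "\<lambda>la. map (beta la) [0..<length la]"
  have sorted: "sorted (rev (?b la)) \<and> distinct (rev (?b la)) \<and> set (rev (?b la)) = beta_set la"
    if "is_partition la" for la
  proof (intro conjI)
    have "sorted_wrt (\<lambda>x y. y < x) (?b la)"
      using beta_strict_antimono[OF that] by (auto simp: sorted_wrt_iff_nth_less)
    then have "sorted_wrt (<) (rev (?b la))"
      by (simp add: sorted_wrt_rev)
    then show "sorted (rev (?b la))" "distinct (rev (?b la))"
      by (auto simp: strict_sorted_iff)
  qed (auto simp: beta_set_def)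
  have len: "length la = length mu"
    using card_beta_set[OF la] card_beta_set[OF mu] eq by simp
  have "rev (?b la) = rev (?b mu)"
    by (rule sorted_distinct_set_unique) (use sorted[OF la] sorted[OF mu] eq in auto)
  then have *: "?b la = ?b mu" by simp
  have "beta la i = beta mu i" if "i < length la" for i
    using arg_cong[OF *, of "\<lambda>l. l ! i"] that len by simp
  then have "la ! i = mu ! i" if "i < length la" for i
    using that len unfolding beta_def by (metis add_right_cancel)
  then show ?thesis
    using len by (intro nth_equalityI)
qed

lemma ex_partition_beta_set:
  assumes "finite X" "0 \<notin> X"
  shows "\<exists>la. is_partition la \<and> beta_set la = X"
proof -
  let ?xs = "sorted_list_of_set X"
  define m where "m = card X"
  have len: "length ?xs = m" by (simp add: m_def)
  have less: "?xs ! i < ?xs ! j" if "i < j" "j < m" for i j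
    using that strict_sorted_list_of_set[of X] len by (simp add: sorted_wrt_iff_nth_less)
  have pos: "0 < ?xs ! i" if "i < m" for i
    using that assms len by (metis gr0I nth_mem set_sorted_list_of_set)
  have gap: "?xs ! i + (j - i) \<le> ?xs ! j" if "i \<le> j" "j < m" for i j
    using that
  proof (induction j)
    case (Suc j)
    then show ?case
      using less[of j "Suc j"] by (cases "i = Suc j") (auto simp: Suc_diff_le)
  qed simp
  have ge: "i < ?xs ! i" if "i < m" for i
    using gap[of 0 i] pos[of 0] that by simp
  \<comment> \<open>This inverts \<open>beta\<close>: from each element of \<open>X\<close>, in
    decreasing order, subtract the number \<open>m - 1 - i\<close> of smaller elements.\<close>
  define la where "la = map (\<lambda>i. ?xs ! (m - 1 - i) - (m - 1 - i)) [0..<m]"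
  have nth: "la ! i = ?xs ! (m - 1 - i) - (m - 1 - i)" if "i < m" for i
    using that by (simp add: la_def)
  have lla: "length la = m" by (simp add: la_def)
  have "is_partition la"
    unfolding is_partition_def
  proof
    show "sorted_wrt (\<lambda>a b. b \<le> a) la"
      unfolding sorted_wrt_iff_nth_less lla
    proof (intro allI impI)
      fix i j assume "i < j" "j < m"
      have "?xs ! a - a \<le> ?xs ! b - b" if "a \<le> b" "b < m" for a b
        using gap[OF that] ge[of a] that by simp
      from this[of "m - 1 - j" "m - 1 - i"] show "la ! j \<le> la ! i"
        using \<open>i < j\<close> \<open>j < m\<close> by (simp add: nth)
    qed
    show "0 \<notin> set la"
    proof
      assume "0 \<in> set la"
      then obtain i where "i < m" "la ! i = 0" by (auto simp: in_set_conv_nth lla)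
      then show False using ge[of "m - 1 - i"] by (simp add: nth)
    qed
  qed
  moreover have "beta_set la = X"
  proof -
    have b: "beta la i = ?xs ! (m - 1 - i)" if "i < m" for i
      using that ge[of "m - 1 - i"] by (simp add: beta_def nth lla)
    have "beta_set la = (\<lambda>i. ?xs ! (m - 1 - i)) ` {..<m}"
      unfolding beta_set_def lla by (rule image_cong) (use b in auto)
    also have "\<dots> = (\<lambda>i. ?xs ! i) ` ((\<lambda>i. m - 1 - i) ` {..<m})"
      by (simp add: image_image)
    also have "(\<lambda>i. m - 1 - i) ` {..<m} = {..<m}"
    proof (intro equalityI subsetI)
      fix j assume "j \<in> {..<m}"
      then show "j \<in> (\<lambda>i. m - 1 - i) ` {..<m}"
        by (intro image_eqI[of _ _ "m - 1 - j"]) auto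
    qed auto
    also have "(\<lambda>i. ?xs ! i) ` {..<m} = set ?xs"
      by (auto simp: set_conv_nth m_def)
    also have "\<dots> = X" using assms by simp
    finally show ?thesis .
  qed
  ultimately show ?thesis by blast
qed

section \<open>Hook lengths in a row and closure under subtraction\<close>

lemma less_conj_part_iff:
  assumes "is_partition la"
  shows "i < conj_part la j \<longleftrightarrow> i < length la \<and> j < la ! i"
proof -
  have "{i. i < length la \<and> j < la ! i} = {..<conj_part la j}"
    unfolding conj_part_def
  proof (rule down_closed_eq_lessThan)
    fix i i' assume "i \<in> {i. i < length la \<and> j < la ! i}" "i' \<le> i"
    then show "i' \<in> {i. i < length la \<and> j < la ! i}"
      using is_partition_nth_mono[OF assms, of i' i] by auto
  qed simp
  then show ?thesis by blast
qed

text \<open>Number the boundary steps of the diagram from the bottom left. Vertical steps carry the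
  numbers in \<open>beta_set la\<close>, horizontal steps the remaining ones, and a hook length is
  the difference between the vertical step of its row and the horizontal step of its column.\<close>

lemma hook_lengths_in_row:
  assumes la: "is_partition la" and i: "i < length la"
  shows "hook la i ` {..<la ! i} = (\<lambda>y. beta la i - y) ` {y. y < beta la i \<and> y \<notin> beta_set la}"
proof -
  \<comment> \<open>The number of the horizontal step of column \<open>j\<close>: it is preceded by
    \<open>j\<close> columns and by the rows too short to reach column \<open>j\<close>.\<close>
  define y where "y j = j + (length la - conj_part la j)" for j
  have conj_le: "conj_part la j \<le> length la" for j
    using less_conj_part_iff[OF la, of "length la" j] by simp
  have hook: "hook la i j = beta la i - y j" and y_less: "y j < beta la i" if "j < la ! i" for j
    using that i conj_le[of j] less_conj_part_iff[OF la, of i j]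
    by (auto simp: hook_def beta_def y_def)
  have conj_mono: "conj_part la k \<le> conj_part la j" if "j \<le> k" for j k
    using that less_conj_part_iff[OF la, of "conj_part la j" k]
      less_conj_part_iff[OF la, of "conj_part la j" j] by (meson leI le_less_trans less_irrefl)
  have "strict_mono y"
    using conj_mono by (intro strict_monoI) (simp add: y_def add_less_le_mono diff_le_mono2)
  have y_notin: "y j \<notin> beta_set la" for j
  proof
    assume "y j \<in> beta_set la"
    then obtain r where r: "r < length la" "y j = beta la r"
      by (auto simp: beta_set_def)
    show False
      \<comment> \<open>A row \<open>r\<close> that reaches column \<open>j\<close> has
        \<open>beta la r > y j\<close>; any other row has \<open>beta la r < y j\<close>.\<close>
      using less_conj_part_iff[OF la, of r j] r conj_le[of j]
      by (cases "r < conj_part la j") (auto simp: y_def beta_def)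
  qed
  \<comment> \<open>The numbers below the first-column hook of row \<open>i\<close> that are not first-column hooks
    are as many as the row has cells, so \<open>y\<close> hits all of them.\<close>
  have "y ` {..<la ! i} = {y. y < beta la i \<and> y \<notin> beta_set la}"
  proof (rule card_subset_eq)
    have "{y. y < beta la i \<and> y \<in> beta_set la} = beta la ` {i<..<length la}"
    proof (intro equalityI subsetI)
      fix z assume "z \<in> {y. y < beta la i \<and> y \<in> beta_set la}"
      then obtain r where r: "r < length la" "z = beta la r" "beta la r < beta la i"
        by (auto simp: beta_set_def)
      then have "i < r"
        using beta_strict_antimono[OF la, of r i] i by (metis less_asym less_irrefl linorder_neqE_nat)
      then show "z \<in> beta la ` {i<..<length la}" using r by auto
    qed (use beta_strict_antimono[OF la, of i] in \<open>auto simp: beta_set_def\<close>)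
    then have "card {y. y < beta la i \<and> y \<in> beta_set la} = length la - Suc i"
      using inj_on_subset[OF inj_on_beta[OF la], of "{i<..<length la}"]
      by (simp add: card_image subset_iff)
    moreover have "{y. y < beta la i \<and> y \<notin> beta_set la} = {..<beta la i} - {y. y < beta la i \<and> y \<in> beta_set la}"
      by auto
    ultimately have "card {y. y < beta la i \<and> y \<notin> beta_set la} = la ! i"
      by (simp add: card_Diff_subset subset_iff beta_def)
    moreover have "card (y ` {..<la ! i}) = la ! i"
      using \<open>strict_mono y\<close> by (simp add: card_image strict_mono_imp_inj_on)
    ultimately show "card (y ` {..<la ! i}) = card {y. y < beta la i \<and> y \<notin> beta_set la}"
      by simp
  qed (use y_less y_notin in auto)
  then have "(\<lambda>y. beta la i - y) ` {y. y < beta la i \<and> y \<notin> beta_set la} = (\<lambda>j. beta la i - y j) ` {..<la ! i}"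
    by (metis image_image)
  then show ?thesis
    using hook by (auto simp: image_iff)
qed

text \<open>By the description of the hooks in a row, a hook divisible by \<open>t\<close> is an
  element \<open>x\<close> with a smaller non-element at a distance divisible by \<open>t\<close>.
  Descending from \<open>x\<close> in steps of \<open>t\<close> reduces this to single
  steps.\<close>

lemma no_hook_dvd_iff:
  assumes la: "is_partition la"
  shows "(\<forall>(i, j) \<in> cells la. \<not> t dvd hook la i j) \<longleftrightarrow>
    (\<forall>x \<in> beta_set la. t \<le> x \<longrightarrow> x - t \<in> beta_set la)"
proof -
  have "(\<forall>(i, j) \<in> cells la. \<not> t dvd hook la i j) \<longleftrightarrow>
      (\<forall>i<length la. \<forall>d \<in> hook la i ` {..<la ! i}. \<not> t dvd d)"
    by (auto simp: cells_def)
  also have "\<dots> \<longleftrightarrow> (\<forall>x \<in> beta_set la. \<forall>y<x. y \<notin> beta_set la \<longrightarrow> \<not> t dvd x - y)"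
    using hook_lengths_in_row[OF la] by (auto simp: beta_set_def)
  also have "\<dots> \<longleftrightarrow> (\<forall>x \<in> beta_set la. t \<le> x \<longrightarrow> x - t \<in> beta_set la)"
  proof (intro iffI ballI allI impI notI)
    fix x assume *: "\<forall>x \<in> beta_set la. \<forall>y<x. y \<notin> beta_set la \<longrightarrow> \<not> t dvd x - y" "x \<in> beta_set la" "t \<le> x"
    show "x - t \<in> beta_set la"
    proof (cases "t = 0")
      case False
      then have "x - t < x" "t dvd x - (x - t)" using \<open>t \<le> x\<close> by auto
      then show ?thesis using * by blast
    qed (use * in simp)
  next
    fix x y
    assume closed: "\<forall>x \<in> beta_set la. t \<le> x \<longrightarrow> x - t \<in> beta_set la"
      and "x \<in> beta_set la" "y < x" "y \<notin> beta_set la" "t dvd x - y"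
    obtain k where k: "x - y = t * k" using \<open>t dvd x - y\<close> by blast
    have "x - t * m \<in> beta_set la" if "m \<le> k" for m
      using that
    proof (induction m)
      case (Suc m)
      then have "t * Suc m \<le> t * k" by (intro mult_le_mono2)
      then have "t * m + t \<le> x" using k by simp
      then show ?case using Suc closed by (auto simp: algebra_simps)
    qed (use \<open>x \<in> beta_set la\<close> in simp)
    from this[of k] show False
      using k \<open>y < x\<close> \<open>y \<notin> beta_set la\<close> by (metis diff_diff_cancel less_imp_le order_refl)
  qed
  finally show ?thesis .
qed

text \<open>As 0 is excluded, the closure condition also keeps \<open>s\<close>,
  \<open>s + 1\<close> and \<open>s + 2\<close> themselves out of \<open>X\<close>.\<close>

definition core_beta_sets :: "nat \<Rightarrow> nat set set" where
  "core_beta_sets s = {X. finite X \<and> 0 \<notin> X \<and>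
     (\<forall>x \<in> X. \<forall>t \<in> {s, s + 1, s + 2}. t \<le> x \<longrightarrow> x - t \<in> X)}"

lemma is_core3_iff_beta_set:
  "is_core3 s la \<longleftrightarrow> is_partition la \<and> beta_set la \<in> core_beta_sets s"
proof (cases "is_partition la")
  case True
  have "is_core3 s la \<longleftrightarrow> (\<forall>t \<in> {s, s + 1, s + 2}. \<forall>(i, j) \<in> cells la. \<not> t dvd hook la i j)"
    using True unfolding is_core3_def by blast
  also have "\<dots> \<longleftrightarrow> beta_set la \<in> core_beta_sets s"
    unfolding no_hook_dvd_iff[OF True] core_beta_sets_def using beta_set_pos[OF True] by auto
  finally show ?thesis using True by simp
qed (simp add: is_core3_def)

lemma bij_betw_beta_set: "bij_betw beta_set {la. is_core3 s la} (core_beta_sets s)"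
  unfolding bij_betw_def
proof
  show "inj_on beta_set {la. is_core3 s la}"
    by (auto intro!: inj_onI beta_set_inject simp: is_core3_iff_beta_set)
  show "beta_set ` {la. is_core3 s la} = core_beta_sets s"
  proof (intro equalityI subsetI)
    fix X assume X: "X \<in> core_beta_sets s"
    then obtain la where "is_partition la" "beta_set la = X"
      using ex_partition_beta_set[of X] by (auto simp: core_beta_sets_def)
    then show "X \<in> beta_set ` {la. is_core3 s la}"
      using X by (auto simp: is_core3_iff_beta_set)
  qed (auto simp: is_core3_iff_beta_set)
qed

section \<open>Motzkin paths as height lists\<close>

text \<open>A path of \<open>n\<close> steps is stored as its \<open>n + 1\<close> heights, and the
  type \<open>nat\<close> keeps it from going below the axis. The starting height \<open>k\<close>
  is free so that steps can be removed one by one.\<close>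

definition motzkin_paths :: "nat \<Rightarrow> nat \<Rightarrow> nat list set" where
  "motzkin_paths n k = {f. length f = Suc n \<and> f ! 0 = k \<and> f ! n = 0 \<and>
     (\<forall>i<n. f ! i \<le> Suc (f ! Suc i) \<and> f ! Suc i \<le> Suc (f ! i))}"

lemma length_motzkin_paths: "f \<in> motzkin_paths n k \<Longrightarrow> length f = Suc n"
  by (simp add: motzkin_paths_def)

lemma motzkin_paths_0: "motzkin_paths 0 k = (if k = 0 then {[0]} else {})"
  by (auto simp: motzkin_paths_def length_Suc_conv)

text \<open>Subtraction is truncated: for \<open>k = 0\<close> the range starts at 0, so the
  forbidden down step drops out.\<close>

lemma motzkin_paths_Suc:
  "motzkin_paths (Suc n) k = (\<Union>j\<in>{k - 1..Suc k}. (#) k ` motzkin_paths n j)"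
proof (intro equalityI subsetI)
  fix f assume f: "f \<in> motzkin_paths (Suc n) k"
  then obtain g where g: "f = k # g"
    by (auto simp: motzkin_paths_def length_Suc_conv)
  have "g ! 0 \<in> {k - 1..Suc k}"
    using f by (auto simp: motzkin_paths_def g All_less_Suc2)
  moreover have "g \<in> motzkin_paths n (g ! 0)"
    using f by (auto simp: motzkin_paths_def g All_less_Suc2)
  ultimately show "f \<in> (\<Union>j\<in>{k - 1..Suc k}. (#) k ` motzkin_paths n j)"
    using g by blast
qed (auto simp: motzkin_paths_def All_less_Suc2)

lemma finite_motzkin_paths [simp]: "finite (motzkin_paths n k)"
  by (induction n arbitrary: k) (auto simp: motzkin_paths_0 motzkin_paths_Suc)

lemma sum_motzkin_paths_Suc:
  fixes \<phi> :: "nat list \<Rightarrow> 'a :: comm_monoid_add"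
  shows "sum \<phi> (motzkin_paths (Suc n) k) = (\<Sum>j\<in>{k - 1..Suc k}. \<Sum>f\<in>motzkin_paths n j. \<phi> (k # f))"
proof -
  have "sum \<phi> (motzkin_paths (Suc n) k) = (\<Sum>j\<in>{k - 1..Suc k}. sum \<phi> ((#) k ` motzkin_paths n j))"
    unfolding motzkin_paths_Suc
    by (rule sum.UNION_disjoint) (simp, simp, auto simp: motzkin_paths_def)
  also have "\<dots> = (\<Sum>j\<in>{k - 1..Suc k}. \<Sum>f\<in>motzkin_paths n j. \<phi> (k # f))"
    by (rule sum.cong[OF refl]) (simp add: sum.reindex)
  finally show ?thesis .
qed

text \<open>Cut the path at its first visit to height 0. The part before it stays at height at least
  1, hence is a raised path \<open>map Suc g\<close>; one down step joins it to
  \<open>q\<close>.\<close>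

lemma sum_motzkin_paths_first_passage:
  fixes \<phi> :: "nat list \<Rightarrow> 'a :: comm_monoid_add"
  shows "sum \<phi> (motzkin_paths n (Suc k)) =
    (\<Sum>i<n. \<Sum>g\<in>motzkin_paths i k. \<Sum>q\<in>motzkin_paths (n - Suc i) 0. \<phi> (map Suc g @ q))"
proof (induction n arbitrary: k \<phi>)
  case 0
  show ?case by (simp add: motzkin_paths_0)
next
  case (Suc n)
  let ?S = "\<lambda>j. \<Sum>f\<in>motzkin_paths n j. \<phi> (Suc k # f)"
  \<comment> \<open>The term \<open>i = 0\<close> is the path that steps down at once, possible only
    for \<open>k = 0\<close>. In the other terms the first height is split off, and the induction
    hypothesis applies to the statistic with that height prefixed.\<close>
  have "(\<Sum>i<Suc n. \<Sum>g\<in>motzkin_paths i k. \<Sum>q\<in>motzkin_paths (Suc n - Suc i) 0. \<phi> (map Suc g @ q)) =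
      (if k = 0 then ?S 0 else 0) +
      (\<Sum>i<n. \<Sum>j\<in>{k - 1..Suc k}. \<Sum>g\<in>motzkin_paths i j. \<Sum>q\<in>motzkin_paths (n - Suc i) 0.
        \<phi> (Suc k # map Suc g @ q))"
    by (subst sum.lessThan_Suc_shift) (simp add: motzkin_paths_0 sum_motzkin_paths_Suc)
  also have "\<dots> = (if k = 0 then ?S 0 else 0) + (\<Sum>j\<in>{k - 1..Suc k}. ?S (Suc j))"
    by (subst sum.swap) (simp add: Suc)
  also have "\<dots> = (\<Sum>j\<in>{Suc k - 1..Suc (Suc k)}. ?S j)"
  proof (cases k)
    case 0
    then show ?thesis by (simp add: numeral_2_eq_2 add.assoc)
  next
    case (Suc m)
    have "(\<Sum>j\<in>{m..Suc (Suc m)}. ?S (Suc j)) = (\<Sum>j\<in>{Suc m..Suc (Suc (Suc m))}. ?S j)"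
      by (rule sum.shift_bounds_cl_Suc_ivl[symmetric])
    then show ?thesis using Suc by simp
  qed
  also have "\<dots> = sum \<phi> (motzkin_paths (Suc n) (Suc k))"
    by (rule sum_motzkin_paths_Suc[symmetric])
  finally show ?case by simp
qed

lemma sum_motzkin_paths_first_return:
  fixes \<phi> :: "nat list \<Rightarrow> 'a :: comm_monoid_add"
  shows "sum \<phi> (motzkin_paths (Suc n) 0) = (\<Sum>f\<in>motzkin_paths n 0. \<phi> (0 # f)) +
    (\<Sum>i<n. \<Sum>g\<in>motzkin_paths i 0. \<Sum>q\<in>motzkin_paths (n - Suc i) 0. \<phi> (0 # map Suc g @ q))"
  using sum_motzkin_paths_first_passage[of "\<lambda>f. \<phi> (0 # f)" n 0]
  by (simp add: sum_motzkin_paths_Suc)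

lemma rev_motzkin_paths: "f \<in> motzkin_paths n 0 \<Longrightarrow> rev f \<in> motzkin_paths n 0"
proof -
  assume f: "f \<in> motzkin_paths n 0"
  have "f ! (n - i) \<le> Suc (f ! (n - Suc i)) \<and> f ! (n - Suc i) \<le> Suc (f ! (n - i))" if "i < n" for i
  proof -
    have "n - Suc i < n" "Suc (n - Suc i) = n - i" using that by auto
    then show ?thesis using f unfolding motzkin_paths_def by (metis (no_types, lifting) mem_Collect_eq)
  qed
  then show "rev f \<in> motzkin_paths n 0"
    using f by (auto simp: motzkin_paths_def rev_nth)
qed

section \<open>Core partitions and Motzkin paths\<close>

definition abacus_set :: "nat \<Rightarrow> nat list \<Rightarrow> nat set" where
  "abacus_set s f = {x. x div Suc s < f ! (x mod Suc s)}"

lemma abacus_set_iff: "c \<le> s \<Longrightarrow> c + k * Suc s \<in> abacus_set s f \<longleftrightarrow> k < f ! c"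
  unfolding abacus_set_def mem_Collect_eq by (subst div_mult_self1, simp) (subst mod_mult_self1, simp)

lemma abacus_set_eq_image:
  "abacus_set s f = (\<lambda>(c, k). c + k * Suc s) ` (SIGMA c:{..s}. {..<f ! c})"
proof (intro equalityI subsetI)
  fix x assume "x \<in> abacus_set s f"
  then have "(x mod Suc s, x div Suc s) \<in> (SIGMA c:{..s}. {..<f ! c})"
    by (simp add: abacus_set_def less_Suc_eq_le[symmetric])
  moreover have "x = (\<lambda>(c, k). c + k * Suc s) (x mod Suc s, x div Suc s)"
    by (simp only: prod.case mod_div_mult_eq)
  ultimately show "x \<in> (\<lambda>(c, k). c + k * Suc s) ` (SIGMA c:{..s}. {..<f ! c})"
    by (rule rev_image_eqI)
qed (auto simp only: mem_Sigma_iff abacus_set_iff split_def image_iff fst_conv snd_conv)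

lemma inj_on_abacus: "inj_on (\<lambda>(c, k). c + k * Suc s) (SIGMA c:{..s}. {..<f c :: nat})"
proof (rule inj_onI, clarify)
  fix c k d l assume "c \<le> s" "d \<le> s" and eq: "c + k * Suc s = d + l * Suc s"
  have "c = d"
    using arg_cong[OF eq, of "\<lambda>x. x mod Suc s"] \<open>c \<le> s\<close> \<open>d \<le> s\<close>
    by (simp only: mod_mult_self1 mod_less le_imp_less_Suc)
  then show "c = d \<and> k = l"
    using eq by (simp only: add_left_cancel mult_cancel2) simp
qed

lemma finite_abacus_set: "finite (abacus_set s f)"
  unfolding abacus_set_eq_image by simp

lemma sum_abacus_set: "\<Sum>(abacus_set s f) = (\<Sum>c\<le>s. \<Sum>k<f ! c. c + k * Suc s)"
  unfolding abacus_set_eq_image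
  by (subst sum.reindex[OF inj_on_abacus]) (simp add: sum.Sigma split_def o_def)

lemma card_abacus_set: "card (abacus_set s f) = (\<Sum>c\<le>s. f ! c)"
  unfolding abacus_set_eq_image by (subst card_image[OF inj_on_abacus]) simp

text \<open>Subtracting \<open>s\<close>, \<open>s + 1\<close> or \<open>s + 2\<close> lowers a bead
  by one level and moves it from runner \<open>c\<close> to runner \<open>c + 1\<close>,
  \<open>c\<close> or \<open>c - 1\<close>. The bounds on the steps of \<open>f\<close> ensure that
  a bead is there.\<close>

lemma abacus_set_in_core_beta_sets:
  assumes f: "f \<in> motzkin_paths s 0"
  shows "abacus_set s f \<in> core_beta_sets s"
proof -
  have f0: "f ! 0 = 0" and fs: "f ! s = 0"
    and steps: "\<And>i. i < s \<Longrightarrow> f ! i \<le> Suc (f ! Suc i)" "\<And>i. i < s \<Longrightarrow> f ! Suc i \<le> Suc (f ! i)"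
    using f by (auto simp: motzkin_paths_def)
  have "x - t \<in> abacus_set s f"
    if "x \<in> abacus_set s f" and t: "t \<in> {s, s + 1, s + 2}" and "t \<le> x" for x t
  proof -
    obtain c k where c: "c \<le> s" and k: "k < f ! c" and x: "x = c + k * Suc s"
      using \<open>x \<in> abacus_set s f\<close> unfolding abacus_set_eq_image by auto
    \<comment> \<open>Runners \<open>0\<close> and \<open>s\<close> are empty, so both neighbours of
      runner \<open>c\<close> exist. Level 0 is impossible, as there \<open>x = c < s\<close>, which
      is at most \<open>t\<close>.\<close>
    have "c < s" using c k fs by (metis le_neq_implies_less not_less_zero)
    obtain c' where c': "c = Suc c'" using k f0 by (cases c) auto
    have "k \<noteq> 0" using \<open>t \<le> x\<close> t x \<open>c < s\<close> by (cases k) auto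
    then obtain k' where k': "k = Suc k'" by (cases k) auto
    consider "x - t = Suc c + k' * Suc s" | "x - t = c + k' * Suc s" | "x - t = c' + k' * Suc s"
      using t x c' k' by auto
    then show ?thesis
    proof cases
      case 1
      then show ?thesis using abacus_set_iff[of "Suc c" s k' f] steps(1)[of c] k k' \<open>c < s\<close> by simp
    next
      case 2
      then show ?thesis using abacus_set_iff[of c s k' f] k k' c by simp
    next
      case 3
      then show ?thesis using abacus_set_iff[of c' s k' f] steps(2)[of c'] k k' c' \<open>c < s\<close> by simp
    qed
  qed
  moreover have "0 \<notin> abacus_set s f"
    using f0 by (simp add: abacus_set_def)
  ultimately show ?thesis
    by (simp add: core_beta_sets_def finite_abacus_set)
qed

lemma ex_motzkin_path_abacus_set:
  assumes X: "X \<in> core_beta_sets s"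
  shows "\<exists>f\<in>motzkin_paths s 0. abacus_set s f = X"
proof -
  have "finite X" "0 \<notin> X"
    and closed: "\<And>x t. x \<in> X \<Longrightarrow> t \<in> {s, s + 1, s + 2} \<Longrightarrow> t \<le> x \<Longrightarrow> x - t \<in> X"
    using X by (auto simp: core_beta_sets_def)
  \<comment> \<open>The number of beads on runner \<open>c\<close>; closure under subtracting
    \<open>s + 1\<close> shows that they fill its lowest levels.\<close>
  define f where "f = map (\<lambda>c. card {k. c + k * Suc s \<in> X}) [0..<Suc s]"
  have f: "k < f ! c \<longleftrightarrow> c + k * Suc s \<in> X" if "c \<le> s" for c k
  proof -
    have "{k. c + k * Suc s \<in> X} = {..<card {k. c + k * Suc s \<in> X}}"
    proof (rule down_closed_eq_lessThan)
      have "inj (\<lambda>k. c + k * Suc s)" by (rule injI) (simp del: mult_Suc_right)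
      from finite_vimageI[OF \<open>finite X\<close> this] show "finite {k. c + k * Suc s \<in> X}"
        by (simp add: vimage_def)
    next
      fix x y assume "x \<in> {k. c + k * Suc s \<in> X}" and "y \<le> x"
      have "c + y * Suc s \<in> X"
        using \<open>y \<le> x\<close>
      proof (induction rule: inc_induct)
        case (step n)
        then show ?case using closed[of "c + Suc n * Suc s" "s + 1"] by simp
      qed (use \<open>x \<in> _\<close> in simp)
      then show "y \<in> {k. c + k * Suc s \<in> X}" by simp
    qed
    moreover have "f ! c = card {k. c + k * Suc s \<in> X}"
      using that by (simp add: f_def del: upt_Suc)
    ultimately show ?thesis by auto
  qed
  have "f ! 0 = 0" using f[of 0 0] \<open>0 \<notin> X\<close> by simp
  \<comment> \<open>If \<open>s\<close> were in \<open>X\<close>, then so would be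
    \<open>s - s = 0\<close>.\<close>
  moreover have "f ! s = 0" using f[of s 0] closed[of s s] \<open>0 \<notin> X\<close> by auto
  moreover have "f ! i \<le> Suc (f ! Suc i)" if "i < s" for i
  proof (rule ccontr)
    assume "\<not> ?thesis"
    then have "i + Suc (f ! Suc i) * Suc s \<in> X" using f[of i "Suc (f ! Suc i)"] that by simp
    then have "Suc i + (f ! Suc i) * Suc s \<in> X" using closed[of "i + Suc (f ! Suc i) * Suc s" s] by simp
    then show False using f[of "Suc i" "f ! Suc i"] that by simp
  qed
  moreover have "f ! Suc i \<le> Suc (f ! i)" if "i < s" for i
  proof (rule ccontr)
    assume "\<not> ?thesis"
    then have "Suc i + Suc (f ! i) * Suc s \<in> X" using f[of "Suc i" "Suc (f ! i)"] that by simp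
    then have "i + (f ! i) * Suc s \<in> X" using closed[of "Suc i + Suc (f ! i) * Suc s" "s + 2"] by simp
    then show False using f[of i "f ! i"] that by simp
  qed
  moreover have "length f = Suc s" by (simp add: f_def)
  ultimately have "f \<in> motzkin_paths s 0"
    by (simp add: motzkin_paths_def)
  moreover have "abacus_set s f = X"
  proof (rule set_eqI)
    fix x
    have "x \<in> abacus_set s f \<longleftrightarrow> x mod Suc s + x div Suc s * Suc s \<in> X"
      unfolding abacus_set_def mem_Collect_eq by (rule f) (simp add: less_Suc_eq_le[symmetric])
    then show "x \<in> abacus_set s f \<longleftrightarrow> x \<in> X"
      by (simp only: mod_div_mult_eq)
  qed
  ultimately show ?thesis by blast
qed

lemma bij_betw_abacus_set: "bij_betw (abacus_set s) (motzkin_paths s 0) (core_beta_sets s)"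
  unfolding bij_betw_def
proof
  show "inj_on (abacus_set s) (motzkin_paths s 0)"
  proof (rule inj_onI)
    fix f g assume fg: "f \<in> motzkin_paths s 0" "g \<in> motzkin_paths s 0" "abacus_set s f = abacus_set s g"
    have "f ! c = g ! c" if "c \<le> s" for c
      using abacus_set_iff[OF that, of _ f] abacus_set_iff[OF that, of _ g] fg(3)
      by (metis less_irrefl linorder_neqE_nat)
    then show "f = g"
      using fg(1,2) by (intro nth_equalityI) (auto simp: length_motzkin_paths)
  qed
  show "abacus_set s ` motzkin_paths s 0 = core_beta_sets s"
    using abacus_set_in_core_beta_sets[of _ s] ex_motzkin_path_abacus_set[of _ s] by fast
qed

lemma real_sum_lessThan: "2 * real (\<Sum>{..<m}) = real m * (real m - 1)"
  by (induction m) (auto simp: algebra_simps)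

lemma two_h_eq_sum_motzkin_paths:
  "2 * real (h s) = (\<Sum>f\<in>motzkin_paths s 0.
     real (length f) * (\<Sum>a\<leftarrow>f. (real a)\<^sup>2) - (real (sum_list f))\<^sup>2)"
proof -
  let ?P = "motzkin_paths s 0"
  let ?w = "\<lambda>X. real (\<Sum>X) - real (\<Sum>{..<card X})"
  let ?q = "\<lambda>f. real (length f) * (\<Sum>a\<leftarrow>f. (real a)\<^sup>2) - (real (sum_list f))\<^sup>2"
  let ?a = "\<lambda>f. \<Sum>c\<le>s. (2 * real c - real s) * real (f ! c)"
  have "real (h s) = (\<Sum>la | is_core3 s la. ?w (beta_set la))"
    unfolding h_def of_nat_sum[of psize]
    by (intro sum.cong refl) (simp add: sum_beta_set is_core3_def del: of_nat_sum)
  also have "\<dots> = sum ?w (core_beta_sets s)"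
    by (rule sum.reindex_bij_betw[OF bij_betw_beta_set])
  also have "\<dots> = (\<Sum>f\<in>?P. ?w (abacus_set s f))"
    by (rule sum.reindex_bij_betw[OF bij_betw_abacus_set, symmetric])
  finally have "2 * real (h s) = (\<Sum>f\<in>?P. 2 * ?w (abacus_set s f))"
    by (simp add: sum_distrib_left)
  \<comment> \<open>Runner \<open>c\<close> with \<open>m\<close> beads contributes
    \<open>2 c m + (s + 1) m (m - 1)\<close>, and for \<open>A\<close> beads in all
    \<open>A (A - 1)\<close> is subtracted. The linear terms combine to \<open>(2 c - s) m\<close>,
    summed in \<open>?a\<close>.\<close>
  also have "\<dots> = (\<Sum>f\<in>?P. ?a f + ?q f)"
  proof (intro sum.cong refl)
    fix f assume "f \<in> ?P"
    then have len: "length f = Suc s" by (rule length_motzkin_paths)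
    have A: "real (sum_list f) = (\<Sum>c\<le>s. real (f ! c))"
      by (simp add: sum_list_sum_nth len atLeast0LessThan lessThan_Suc_atMost)
    have Q: "(\<Sum>a\<leftarrow>f. (real a)\<^sup>2) = (\<Sum>c\<le>s. (real (f ! c))\<^sup>2)"
      by (simp add: sum_list_sum_nth len atLeast0LessThan lessThan_Suc_atMost)
    have runner: "real (\<Sum>k<m. c + k * Suc s) = real c * real m + (real s + 1) * (real m * (real m - 1) / 2)"
      for c m
      by (induction m) (auto simp: field_simps)
    have "real (\<Sum>(abacus_set s f)) =
        (\<Sum>c\<le>s. real c * real (f ! c) + (real s + 1) * (real (f ! c) * (real (f ! c) - 1) / 2))"
      unfolding sum_abacus_set of_nat_sum[of _ "{..s}"] runner ..
    also have "2 * \<dots> = ?a f + (real s + 1) * (\<Sum>c\<le>s. (real (f ! c))\<^sup>2) - (\<Sum>c\<le>s. real (f ! c))"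
      unfolding sum_distrib_left sum.distrib[symmetric] sum_subtractf[symmetric]
      by (intro sum.cong refl) (simp add: field_simps power2_eq_square)
    finally show "2 * ?w (abacus_set s f) = ?a f + ?q f"
      unfolding right_diff_distrib real_sum_lessThan card_abacus_set of_nat_sum[of "(!) f"] A Q len
      by (simp add: algebra_simps power2_eq_square del: of_nat_sum)
  qed
  also have "\<dots> = (\<Sum>f\<in>?P. ?a f) + (\<Sum>f\<in>?P. ?q f)"
    by (rule sum.distrib)
  \<comment> \<open>Reversal replaces \<open>c\<close> by \<open>s - c\<close> and so negates
    \<open>2 c - s\<close>; the sum over all paths equals its own negative.\<close>
  also have "(\<Sum>f\<in>?P. ?a f) = 0"
  proof -
    have "bij_betw rev ?P ?P"
      by (rule bij_betw_byWitness[of _ rev]) (auto intro: rev_motzkin_paths)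
    then have "(\<Sum>f\<in>?P. ?a f) = (\<Sum>f\<in>?P. ?a (rev f))"
      by (rule sum.reindex_bij_betw[symmetric])
    also have "\<dots> = (\<Sum>f\<in>?P. - ?a f)"
    proof (intro sum.cong refl)
      fix f assume "f \<in> ?P"
      then have len: "length f = Suc s" by (rule length_motzkin_paths)
      have "?a (rev f) = (\<Sum>c\<le>s. (2 * real c - real s) * real (f ! (s - c)))"
        by (intro sum.cong refl) (simp add: rev_nth len)
      also have "\<dots> = (\<Sum>c\<le>s. (2 * real (s - c) - real s) * real (f ! c))"
        by (rule sum.reindex_bij_witness[of _ "\<lambda>c. s - c" "\<lambda>c. s - c"]) auto
      also have "\<dots> = - ?a f"
        unfolding sum_negf[symmetric]
        by (intro sum.cong refl) (simp add: of_nat_diff algebra_simps)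
      finally show "?a (rev f) = - ?a f" .
    qed
    finally show ?thesis by (simp add: sum_negf)
  qed
  finally show ?thesis by simp
qed

section \<open>Binomial series in a scaled variable\<close>

text \<open>\<open>B a\<close> is the formal power \<open>(1 + c x)^a\<close>. The exponent law
  serves the formal algebra; radius and value carry the result over to real numbers.\<close>

lemma scaled_binomial_series:
  fixes a c :: real
  defines "B \<equiv> \<lambda>a. fps_binomial a oo (fps_const c * fps_X)"
  shows fps_binomial_scaled_add_mult: "B (a + b) = B a * B b"
    and fps_binomial_scaled_0: "B 0 = 1"
    and fps_binomial_scaled_1: "B 1 = 1 + fps_const c * fps_X"
    and fps_conv_radius_binomial_scaled: "c \<noteq> 0 \<Longrightarrow> fps_conv_radius (B a) \<ge> 1 / \<bar>c\<bar>"
    and eval_fps_binomial_scaled: "\<bar>c * x\<bar> < 1 \<Longrightarrow> eval_fps (B a) x = (1 + c * x) powr a"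
proof -
  have [simp]: "fps_nth (fps_const c * fps_X) 0 = 0" by simp
  show "B (a + b) = B a * B b"
    by (simp add: B_def fps_binomial_add_mult fps_compose_mult_distrib)
  show "B 0 = 1" by (simp add: B_def)
  show "B 1 = 1 + fps_const c * fps_X"
    by (simp add: B_def fps_binomial_1 fps_compose_add_distrib)
  have nth: "fps_nth (B a) n = (a gchoose n) * c ^ n" for n a
    by (simp add: B_def fps_compose_linear)
  have sums: "(\<lambda>n. fps_nth (B a) n * x ^ n) sums (1 + c * x) powr a" if "\<bar>c * x\<bar> < 1" for x
    using gen_binomial_real[OF that, of a] by (simp add: nth power_mult_distrib mult.assoc)
  then show "\<bar>c * x\<bar> < 1 \<Longrightarrow> eval_fps (B a) x = (1 + c * x) powr a"
    by (simp add: eval_fps_def sums_iff)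
  show "fps_conv_radius (B a) \<ge> 1 / \<bar>c\<bar>" if "c \<noteq> 0"
    unfolding fps_conv_radius_def
  proof (rule conv_radius_geI_ex')
    fix r :: real assume "0 < r" "ereal r < ereal (1 / \<bar>c\<bar>)"
    then have "\<bar>c * r\<bar> < 1" using that by (simp add: abs_mult field_simps)
    from sums_summable[OF sums[OF this]] show "summable (\<lambda>n. fps_nth (B a) n * of_real r ^ n)" by simp
  qed
qed


section \<open>Generating functions of path statistics\<close>

definition path_gf :: "(nat list \<Rightarrow> real) \<Rightarrow> real fps" where
  "path_gf \<phi> = Abs_fps (\<lambda>n. \<Sum>f\<in>motzkin_paths n 0. \<phi> f)"

text \<open>A Cauchy product over pairs of paths, for weights that need not factor into one weight
  per path.\<close>

definition path_pair_gf :: "(nat list \<Rightarrow> nat list \<Rightarrow> real) \<Rightarrow> real fps" where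
  "path_pair_gf \<psi> = Abs_fps (\<lambda>n. \<Sum>i\<le>n. \<Sum>g\<in>motzkin_paths i 0. \<Sum>q\<in>motzkin_paths (n - i) 0. \<psi> g q)"

lemma path_gf_add: "path_gf (\<lambda>f. \<phi> f + \<psi> f) = path_gf \<phi> + path_gf \<psi>"
  by (simp add: path_gf_def fps_eq_iff sum.distrib)

lemma path_gf_diff: "path_gf (\<lambda>f. \<phi> f - \<psi> f) = path_gf \<phi> - path_gf \<psi>"
  by (simp add: path_gf_def fps_eq_iff sum_subtractf)

lemma path_gf_cmult: "path_gf (\<lambda>f. c * \<phi> f) = fps_const c * path_gf \<phi>"
  by (simp add: path_gf_def fps_eq_iff sum_distrib_left)

text \<open>Coefficient \<open>n\<close> counts lists of length \<open>n + 1\<close>, and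
  multiplying it by \<open>n + 1\<close> is the operator taking \<open>F\<close> to
  \<open>(x F)'\<close>.\<close>

lemma path_gf_length: "path_gf (\<lambda>f. real (length f) * \<phi> f) = fps_deriv (fps_X * path_gf \<phi>)"
proof -
  have "(\<Sum>f\<in>motzkin_paths n 0. real (length f) * \<phi> f) = (\<Sum>f\<in>motzkin_paths n 0. real (Suc n) * \<phi> f)" for n
    by (intro sum.cong refl) (simp only: length_motzkin_paths)
  then show ?thesis
    by (simp add: path_gf_def fps_eq_iff sum_distrib_left sum.distrib algebra_simps)
qed

lemma path_pair_gf_add: "path_pair_gf (\<lambda>g q. \<phi> g q + \<psi> g q) = path_pair_gf \<phi> + path_pair_gf \<psi>"
  by (simp add: path_pair_gf_def fps_eq_iff sum.distrib)

lemma path_pair_gf_mult: "path_pair_gf (\<lambda>g q. \<phi> g * \<psi> q) = path_gf \<phi> * path_gf \<psi>"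
  by (simp add: path_pair_gf_def path_gf_def fps_eq_iff fps_mult_nth sum_product atLeast0AtMost)

lemma path_pair_gf_fst: "path_pair_gf (\<lambda>g q. \<phi> g) = path_gf \<phi> * path_gf (\<lambda>_. 1)"
  using path_pair_gf_mult[of \<phi> "\<lambda>_. 1"] by simp

lemma path_pair_gf_snd: "path_pair_gf (\<lambda>g q. \<psi> q) = path_gf (\<lambda>_. 1) * path_gf \<psi>"
  using path_pair_gf_mult[of "\<lambda>_. 1" \<psi>] by simp

text \<open>\<open>fps_X\<close> marks an initial level step, \<open>fps_X\<^sup>2\<close> the up
  step and the down step around the raised path \<open>g\<close>.\<close>

lemma path_gf_first_return:
  "path_gf \<phi> = fps_const (\<phi> [0]) + fps_X * path_gf (\<lambda>f. \<phi> (0 # f)) +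
     fps_X\<^sup>2 * path_pair_gf (\<lambda>g q. \<phi> (0 # map Suc g @ q))"
proof (rule fps_ext)
  fix n
  show "fps_nth (path_gf \<phi>) n = fps_nth (fps_const (\<phi> [0]) + fps_X * path_gf (\<lambda>f. \<phi> (0 # f)) +
     fps_X\<^sup>2 * path_pair_gf (\<lambda>g q. \<phi> (0 # map Suc g @ q))) n"
  proof (cases n)
    case 0
    then show ?thesis by (simp add: path_gf_def motzkin_paths_0 fps_X_power_mult_nth)
  next
    case (Suc m)
    then show ?thesis
      by (cases m) (simp_all add: path_gf_def path_pair_gf_def sum_motzkin_paths_first_return
          fps_X_power_mult_nth lessThan_Suc_atMost)
  qed
qed

text \<open>This is the formal version of the theorem; the constant term 1 selects one of the two
  square roots.\<close>

lemma h_gf: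
  defines "F \<equiv> Abs_fps (\<lambda>s. real (h s))"
  shows "\<exists>D. D\<^sup>2 = 1 - 2 * fps_X - 3 * fps_X\<^sup>2 \<and> fps_nth D 0 = 1 \<and> F * D ^ 5 = fps_X\<^sup>2"
proof -
  let ?X = "fps_X :: real fps"
  let ?a = "\<lambda>f. real (sum_list f)"
  let ?sq = "\<lambda>f. \<Sum>a\<leftarrow>f. (real a)\<^sup>2"
  define M A Q A2 where "M = path_gf (\<lambda>_. 1)" and "A = path_gf ?a" and "Q = path_gf ?sq"
    and "A2 = path_gf (\<lambda>f. (?a f)\<^sup>2)"
  define L where "L = fps_deriv (?X * M)"
  define D where "D = 1 - ?X - 2 * ?X\<^sup>2 * M"
  have L: "path_gf (\<lambda>f. real (length f)) = L"
    using path_gf_length[of "\<lambda>_. 1"] by (simp add: L_def M_def)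

  have "path_pair_gf (\<lambda>g q. 1) = M * M"
    unfolding path_pair_gf_fst M_def ..
  then have M: "M = 1 + ?X * M + ?X\<^sup>2 * M\<^sup>2"
    using path_gf_first_return[of "\<lambda>_. 1"] by (simp add: M_def power2_eq_square)

  \<comment> \<open>Raising a path adds one for each of its \<open>length g\<close> heights, which
    brings in \<open>L\<close>.\<close>
  have "(\<lambda>g q. ?a (0 # map Suc g @ q)) = (\<lambda>g q. (?a g + real (length g)) + ?a q)"
    by (simp add: sum_list_Suc fun_eq_iff)
  then have "path_pair_gf (\<lambda>g q. ?a (0 # map Suc g @ q)) = (A + L) * M + M * A"
    by (simp only: path_pair_gf_add[of "\<lambda>g q. ?a g + real (length g)"] path_pair_gf_fst path_pair_gf_snd
        path_gf_add L flip: A_def M_def)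
  then have A: "A = ?X * A + ?X\<^sup>2 * ((A + L) * M + M * A)"
    using path_gf_first_return[of ?a] by (simp flip: A_def)

  have "?sq (map Suc g) = ?sq g + 2 * ?a g + real (length g)" for g
    by (induction g) (simp_all add: power2_eq_square algebra_simps)
  then have "(\<lambda>g q. ?sq (0 # map Suc g @ q)) = (\<lambda>g q. (?sq g + 2 * ?a g + real (length g)) + ?sq q)"
    by (simp add: fun_eq_iff)
  then have "path_pair_gf (\<lambda>g q. ?sq (0 # map Suc g @ q)) = (Q + 2 * A + L) * M + M * Q"
    by (simp only: path_pair_gf_add[of "\<lambda>g q. ?sq g + 2 * ?a g + real (length g)"] path_pair_gf_fst path_pair_gf_snd
        path_gf_add path_gf_cmult L numeral_fps_const flip: A_def M_def Q_def)
  then have Q: "Q = ?X * Q + ?X\<^sup>2 * ((Q + 2 * A + L) * M + M * Q)"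
    using path_gf_first_return[of ?sq] by (simp flip: Q_def)

  \<comment> \<open>\<open>?v g\<close> is the height sum of the raised path and \<open>?u g\<close>
    its square; the cross term with \<open>?a q\<close> is a product of two statistics.\<close>
  let ?u = "\<lambda>g. (?a g)\<^sup>2 + 2 * (real (length g) * ?a g) + real (length g) * real (length g)"
  let ?v = "\<lambda>g. ?a g + real (length g)"
  have "(\<lambda>g q. (?a (0 # map Suc g @ q))\<^sup>2) = (\<lambda>g q. (?u g + ?v g * (2 * ?a q)) + (?a q)\<^sup>2)"
    by (simp add: sum_list_Suc fun_eq_iff power2_eq_square algebra_simps)
  then have "path_pair_gf (\<lambda>g q. (?a (0 # map Suc g @ q))\<^sup>2) =
      (A2 + 2 * fps_deriv (?X * A) + fps_deriv (?X * L)) * M + (A + L) * (2 * A) + M * A2"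
    by (simp only: path_pair_gf_add[of "\<lambda>g q. ?u g + ?v g * (2 * ?a q)"] path_pair_gf_add[of "\<lambda>g q. ?u g"]
        path_pair_gf_mult[of ?v] path_pair_gf_fst path_pair_gf_snd path_gf_add path_gf_cmult path_gf_length L
        numeral_fps_const flip: A_def M_def A2_def)
  then have A2: "A2 = ?X * A2 + ?X\<^sup>2 * ((A2 + 2 * fps_deriv (?X * A) + fps_deriv (?X * L)) * M
      + (A + L) * (2 * A) + M * A2)"
    using path_gf_first_return[of "\<lambda>f. (?a f)\<^sup>2"] by (simp flip: A2_def)

  have "2 * F = path_gf (\<lambda>f. real (length f) * ?sq f - (?a f)\<^sup>2)"
    by (simp add: F_def path_gf_def fps_eq_iff numeral_fps_const two_h_eq_sum_motzkin_paths)
  then have F: "2 * F = fps_deriv (?X * Q) - A2"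
    by (simp add: path_gf_diff path_gf_length Q_def A2_def)

  \<comment> \<open>\<open>D\<^sup>2\<close> is the discriminant of the quadratic equation for
    \<open>M\<close>. The equations for \<open>A\<close>, \<open>Q\<close> and \<open>A2\<close> are
    linear in these unknowns with coefficient \<open>D\<close>, so multiplying by powers of
    \<open>D\<close> makes them explicit.\<close>
  have D2: "D\<^sup>2 = 1 - 2 * ?X - 3 * ?X\<^sup>2"
    using M unfolding D_def by algebra
  have D': "D * fps_deriv D = - (1 + 3 * ?X)"
  proof -
    have "2 * (D * fps_deriv D) = 2 * (- (1 + 3 * ?X))"
      using arg_cong[OF D2, of fps_deriv] by (simp add: power2_eq_square algebra_simps)
    then show ?thesis unfolding mult_cancel_left by simp
  qed
  have L_eq: "L = M + ?X * fps_deriv M"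
    by (simp add: L_def)
  have LD: "L * D = M"
  proof -
    have "fps_deriv M = M + ?X * fps_deriv M + 2 * ?X * M\<^sup>2 + 2 * ?X\<^sup>2 * M * fps_deriv M"
      using arg_cong[OF M, of fps_deriv] by (simp add: power2_eq_square algebra_simps)
    then show ?thesis
      unfolding L_eq D_def by algebra
  qed
  have AD: "A * D\<^sup>2 = ?X\<^sup>2 * M\<^sup>2"
  proof -
    have "A * D = ?X\<^sup>2 * M * L" using A unfolding D_def by algebra
    then show ?thesis using LD by algebra
  qed
  have QD: "Q * D ^ 3 = ?X\<^sup>2 * M\<^sup>2 * (1 - ?X)"
  proof -
    have "Q * D = ?X\<^sup>2 * M * (2 * A + L)" using Q unfolding D_def by algebra
    then have "Q * D ^ 3 = ?X\<^sup>2 * M * (2 * (A * D\<^sup>2) + (L * D) * D)" by algebra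
    also have "\<dots> = ?X\<^sup>2 * M\<^sup>2 * (2 * ?X\<^sup>2 * M + D)" unfolding AD LD by algebra
    finally show ?thesis by (simp add: D_def)
  qed
  \<comment> \<open>Since \<open>D' = -(1 + 3 x) / D\<close>, differentiation raises the power of
    \<open>D\<close> needed by two: from 2 to 4 for \<open>A\<close>, 1 to 3 for \<open>L\<close>, 3
    to 5 for \<open>Q\<close>.\<close>
  have A': "fps_deriv (?X * A) * D ^ 4 = ?X\<^sup>2 * M\<^sup>2 * (D\<^sup>2 + 2 * D + 2 * ?X * (1 + 3 * ?X))"
  proof -
    have "fps_deriv A * D\<^sup>2 + 2 * A * (D * fps_deriv D) = 2 * ?X * M * L"
      using arg_cong[OF AD, of fps_deriv] by (simp add: L_eq power2_eq_square algebra_simps)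
    then have "fps_deriv A * D ^ 4 = 2 * ?X * M * (L * D) * D + 2 * (A * D\<^sup>2) * (1 + 3 * ?X)"
      unfolding D' by algebra
    then have "fps_deriv A * D ^ 4 = 2 * ?X * M\<^sup>2 * D + 2 * ?X\<^sup>2 * M\<^sup>2 * (1 + 3 * ?X)"
      unfolding LD AD by algebra
    moreover have "fps_deriv (?X * A) * D ^ 4 = (A * D\<^sup>2) * D\<^sup>2 + ?X * (fps_deriv A * D ^ 4)"
      by (simp add: algebra_simps power2_eq_square power4_eq_xxxx)
    ultimately show ?thesis unfolding AD by algebra
  qed
  have L': "fps_deriv (?X * L) * D ^ 3 = M * D + ?X * M * (1 + 3 * ?X)"
  proof -
    have "fps_deriv L * D + L * fps_deriv D = fps_deriv M"
      using arg_cong[OF LD, of fps_deriv] by (simp add: add.commute)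
    from arg_cong[OF this, of "\<lambda>u. ?X * D\<^sup>2 * u"]
    have "?X * fps_deriv L * D ^ 3 + ?X * (L * D) * (D * fps_deriv D) = (?X * fps_deriv M) * D\<^sup>2"
      by (simp add: algebra_simps power2_eq_square power3_eq_cube)
    moreover have "?X * fps_deriv M = L - M" by (simp add: L_eq)
    ultimately have "?X * fps_deriv L * D ^ 3 = (L * D) * D - M * D\<^sup>2 + ?X * (L * D) * (1 + 3 * ?X)"
      unfolding D' by algebra
    moreover have "fps_deriv (?X * L) * D ^ 3 = (L * D) * D\<^sup>2 + ?X * fps_deriv L * D ^ 3"
      by (simp add: algebra_simps power2_eq_square power3_eq_cube)
    ultimately show ?thesis unfolding LD by algebra
  qed
  have Q': "fps_deriv (?X * Q) * D ^ 5 = ?X\<^sup>2 * M\<^sup>2 *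
      ((1 - 2 * ?X) * D\<^sup>2 + 3 * ?X * (1 - ?X) * (1 + 3 * ?X) + 2 * D * (1 - ?X))"
  proof -
    have "fps_deriv Q * D ^ 3 + 3 * Q * D * (D * fps_deriv D) = 2 * ?X * M * L * (1 - ?X) - ?X\<^sup>2 * M\<^sup>2"
      using arg_cong[OF QD, of fps_deriv] by (simp add: L_eq power2_eq_square power3_eq_cube algebra_simps)
    then have "fps_deriv Q * D ^ 5 = 3 * (Q * D ^ 3) * (1 + 3 * ?X) + 2 * ?X * M * (L * D) * D * (1 - ?X) - ?X\<^sup>2 * M\<^sup>2 * D\<^sup>2"
      unfolding D' by algebra
    then have "fps_deriv Q * D ^ 5 = 3 * (?X\<^sup>2 * M\<^sup>2 * (1 - ?X)) * (1 + 3 * ?X) + 2 * ?X * M * M * D * (1 - ?X) - ?X\<^sup>2 * M\<^sup>2 * D\<^sup>2"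
      unfolding LD QD .
    moreover have "fps_deriv (?X * Q) * D ^ 5 = (Q * D ^ 3) * D\<^sup>2 + ?X * (fps_deriv Q * D ^ 5)"
      by (simp add: algebra_simps power2_eq_square power3_eq_cube numeral_eq_Suc)
    ultimately show ?thesis unfolding QD by algebra
  qed
  have A2D: "A2 * D ^ 5 = ?X\<^sup>2 * M\<^sup>2 * ((1 - ?X - D) * (D\<^sup>2 + 2 * D + 2 * ?X * (1 + 3 * ?X))
      + D\<^sup>2 + ?X * (1 + 3 * ?X) * D + 2 * ?X\<^sup>2)"
  proof -
    have "A2 * D = ?X\<^sup>2 * ((2 * fps_deriv (?X * A) + fps_deriv (?X * L)) * M + 2 * A * (A + L))"
      using A2 unfolding D_def by algebra
    then have "A2 * D ^ 5 = ?X\<^sup>2 * ((2 * (fps_deriv (?X * A) * D ^ 4) + (fps_deriv (?X * L) * D ^ 3) * D) * M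
        + 2 * (A * D\<^sup>2) * (A * D\<^sup>2 + (L * D) * D))" by algebra
    also have "\<dots> = ?X\<^sup>2 * M\<^sup>2 * (2 * ?X\<^sup>2 * M * (D\<^sup>2 + 2 * D + 2 * ?X * (1 + 3 * ?X))
        + D\<^sup>2 + ?X * (1 + 3 * ?X) * D + 2 * ?X\<^sup>2 * M * (?X\<^sup>2 * M + D))"
      unfolding A' L' AD LD by algebra
    \<comment> \<open>The last factor is \<open>1 - ?X - ?X\<^sup>2 * M\<close>, the inverse of
      \<open>M\<close> by the equation for \<open>M\<close>.\<close>
    also have "2 * ?X\<^sup>2 * M * (?X\<^sup>2 * M + D) = 2 * ?X\<^sup>2"
      using M unfolding D_def by algebra
    also have "2 * ?X\<^sup>2 * M = 1 - ?X - D" by (simp add: D_def)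
    finally show ?thesis .
  qed
  \<comment> \<open>The rationalised quadratic formula; it absorbs the remaining factor
    \<open>M\<^sup>2\<close>.\<close>
  have MD: "M * (1 - ?X + D) = 2"
    using M unfolding D_def by algebra
  have "2 * (2 * F) * D ^ 5 = ?X\<^sup>2 * (M * (1 - ?X + D))\<^sup>2"
    using Q' A2D D2 unfolding F by algebra
  then have "4 * (F * D ^ 5) = 4 * ?X\<^sup>2"
    unfolding MD by (simp add: mult.assoc)
  then have "F * D ^ 5 = ?X\<^sup>2" by simp
  moreover have "fps_nth D 0 = 1" by (simp add: D_def)
  ultimately show ?thesis using D2 by blast
qed

section \<open>From the formal series to a convergent sum\<close>

theorem theorem4p2:
  fixes x :: real
  assumes "\<bar>x\<bar> < 1/3"
  shows "(\<lambda>s. real (h s) * x ^ s) sums (x^2 / (1 - 2*x - 3*x^2) powr (5/2))"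
proof -
  let ?X = "fps_X :: real fps"
  define F where "F = Abs_fps (\<lambda>s. real (h s))"
  define B where "B c a = fps_binomial a oo (fps_const c * ?X)" for c a :: real
  note B_add = fps_binomial_scaled_add_mult[folded B_def]
  \<comment> \<open>As \<open>1 - 2 x - 3 x\<^sup>2 = (1 + x) (1 - 3 x)\<close>, \<open>R\<close> is
    again a formal square root, now made of binomial series; \<open>G\<close> is the inverse of its
    fifth power.\<close>
  define R where "R = B 1 (1/2) * B (-3) (1/2)"
  define G where "G = B 1 (-5/2) * B (-3) (-5/2)"
  obtain D where D: "D\<^sup>2 = 1 - 2 * ?X - 3 * ?X\<^sup>2" "fps_nth D 0 = 1" "F * D ^ 5 = ?X\<^sup>2"
    using h_gf unfolding F_def by blast
  have half: "B c (1/2) * B c (1/2) = 1 + fps_const c * ?X" for c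
    using B_add[of c "1/2" "1/2"] fps_binomial_scaled_1[of c, folded B_def] by simp
  have pow: "B c (1/2) ^ n = B c (real n / 2)" for c n
    by (induction n) (simp_all add: fps_binomial_scaled_0[folded B_def] add_divide_distrib
        B_add[symmetric])
  have inv: "B c (1/2) ^ 5 * B c (-5/2) = 1" for c
    unfolding pow by (simp add: B_add[symmetric] fps_binomial_scaled_0[folded B_def])
  have "R ^ 5 * G = (B 1 (1/2) ^ 5 * B 1 (-5/2)) * (B (-3) (1/2) ^ 5 * B (-3) (-5/2))"
    by (simp only: R_def G_def power_mult_distrib mult_ac)
  then have RG: "R ^ 5 * G = 1"
    by (simp only: inv mult_1)
  have "R\<^sup>2 = (B 1 (1/2) * B 1 (1/2)) * (B (-3) (1/2) * B (-3) (1/2))"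
    by (simp add: R_def power2_eq_square mult_ac)
  also have "\<dots> = (1 + ?X) * (1 - 3 * ?X)"
    unfolding half by (simp add: numeral_fps_const flip: fps_const_neg)
  finally have "(R - D) * (R + D) = 0"
    using D(1) by algebra
  \<comment> \<open>Real power series have no zero divisors, so \<open>R\<close> is \<open>D\<close>
    or \<open>- D\<close>; both have constant term 1, which excludes the latter.\<close>
  moreover have "R + D \<noteq> 0"
  proof
    assume "R + D = 0"
    from arg_cong[OF this, of "\<lambda>f. fps_nth f 0"] show False by (simp add: R_def D(2) B_def)
  qed
  ultimately have "R = D"
    by auto
  then have F: "F = ?X\<^sup>2 * G"
    using D(3) RG by (metis mult.assoc mult_1_right)

  \<comment> \<open>The radii are at least 1 and 1/3; the factor in \<open>-3\<close> dictates the
    bound on \<open>x\<close>.\<close>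
  have xB: "ereal (norm x) < fps_conv_radius (B 1 a)" "ereal (norm x) < fps_conv_radius (B (-3) a)" for a
    using less_le_trans[OF _ fps_conv_radius_binomial_scaled[of 1 a, folded B_def], of "ereal (norm x)"]
      less_le_trans[OF _ fps_conv_radius_binomial_scaled[of "-3" a, folded B_def], of "ereal (norm x)"] assms
    by simp_all
  have xG: "ereal (norm x) < fps_conv_radius G"
    using xB unfolding G_def by (intro less_le_trans[OF _ fps_conv_radius_mult]) simp
  have xF: "ereal (norm x) < fps_conv_radius F"
    using xG unfolding F by (intro less_le_trans[OF _ fps_conv_radius_mult]) simp
  have "eval_fps F x = x\<^sup>2 * ((1 + x) powr (-5/2) * (1 + -3 * x) powr (-5/2))"
    using xG xB assms eval_fps_binomial_scaled[of 1 x, folded B_def]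
      eval_fps_binomial_scaled[of "-3" x, folded B_def]
    unfolding F by (subst eval_fps_mult) (simp_all add: G_def eval_fps_mult abs_mult)
  also have "(1 + x) powr (-5/2) * (1 + -3 * x) powr (-5/2) = ((1 + x) * (1 + -3 * x)) powr (-5/2)"
    by (rule powr_mult[symmetric])
  also have "(1 + x) * (1 + -3 * x) = 1 - 2 * x - 3 * x^2"
    by (simp add: algebra_simps power2_eq_square)
  finally have "eval_fps F x = x^2 / (1 - 2*x - 3*x^2) powr (5/2)"
    by (simp add: powr_minus field_simps)
  then show ?thesis
    using sums_eval_fps[OF xF] by (simp add: F_def)
qed

end
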